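(* Let $A\in\mathbb{R}^{n\times d}$ be a nonzero matrix, let $f:\mathbb{R}^n\to\mathbb{R}$ and $g:\mathbb{R}^d\to\mathbb{R}$ be convex, and let $\mu=\sqrt{\lambda_{\min}(A^TA)}$ and $L=\|A\|=\sqrt{\lambda_{\max}(A^TA)}$. Assume that: (i) $f$ is $\delta$-strongly convex and $1/\gamma$-smooth, where $\gamma>0$, $\delta\ge 0$ and $\gamma\delta\le 1$; (ii) $g$ is $\lambda$-strongly convex, where $\lambda\ge 0$; (iii) $\lambda+\delta\mu^2>0$. Let $(x^\star,y^\star)$ be the unique saddle point of $\mathcal{L}(x,y)=g(x)+y^TAx-f^*(y)$ (minimized over $x\in\mathbb{R}^d$, maximized over $y\in\mathbb{R}^n$). Set $$\sigma=\frac1L\sqrt{\frac{\lambda+\delta\mu^2}{\gamma}},\qquad \tau=\frac1L\sqrt{\frac{\gamma}{\lambda+\delta\mu^2}},\qquad \theta=\max\{\theta_x,\theta_y\},$$ where $$\theta_x=\Bigl(1-\frac{\delta}{\delta+2\sigma}\,\frac{\mu^2}{L^2}\Bigr)\frac{1}{1+\tau\lambda},\qquad \theta_y=\frac{1}{1+\sigma\gamma/2}.$$ Let $(x^{(t)},y^{(t)})_{t\ge 0}$ be the iterates of the Batch Primal-Dual (BPD) algorithm (described in the context) run with these parameters $\tau,\sigma,\theta$ from an initial point $(x^{(0)},y^{(0)})\in\mathbb{R}^d\times\mathbb{R}^n$. Then for every $t\ge 1$, $$\Bigl(\frac{1}{2\tau}+\frac{\lambda}{2}\Bigr)\|x^{(t)}-x^\star\|^2+\frac{\gamma}{4}\|y^{(t)}-y^\star\|^2\le\theta^tC,$$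 $$\mathcal{L}(x^{(t)},y^\star)-\mathcal{L}(x^\star,y^{(t)})\le\theta^tC,$$ where $$C=\Bigl(\frac{1}{2\tau}+\frac{\lambda}{2}\Bigr)\|x^{(0)}-x^\star\|^2+\Bigl(\frac{1}{2\sigma}+\frac{\gamma}{4}\Bigr)\|y^{(0)}-y^\star\|^2.$$
   Context: $\|\cdot\|$ is the Euclidean norm for vectors and the spectral norm for matrices. Strong convexity and smoothness are with respect to the Euclidean norm: a function $\phi$ is $\nu$-strongly convex ($\nu\ge0$; $\nu=0$ means just convex) if $\phi-\frac{\nu}{2}\|\cdot\|^2$ is convex, and $1/\gamma$-smooth if it is differentiable with $(1/\gamma)$-Lipschitz gradient. $f^*(y)=\sup_z\{y^Tz-f(z)\}$ is the convex conjugate. For a convex function $\psi$ and $s>0$, $\mathrm{prox}_{s\psi}(z)=\arg\min_x\{s\psi(x)+\frac12\|x-z\|^2\}$. Batch Primal-Dual (BPD) algorithm with parameters $\tau,\sigma,\theta$ and initial point $(x^{(0)},y^{(0)})$: set $\tilde x^{(0)}=x^{(0)}$ and for $t=0,1,2,\ldots$ let $$y^{(t+1)}=\mathrm{prox}_{\sigma f^*}\bigl(y^{(t)}+\sigma A\tilde x^{(t)}\bigr),$$ $$x^{(t+1)}=\mathrm{prox}_{\tau g}\bigl(x^{(t)}-\tau A^Ty^{(t+1)}\bigr),$$ $$\tilde x^{(t+1)}=x^{(t+1)}+\theta\bigl(x^{(t+1)}-x^{(t)}\bigr).$$ *)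

theory Defs
  imports "HOL-Analysis.Analysis"
begin

definition strongly_convex :: "real \<Rightarrow> ('a::real_inner \<Rightarrow> real) \<Rightarrow> bool" where
  "strongly_convex \<nu> \<phi> \<longleftrightarrow> convex_on UNIV (\<lambda>x. \<phi> x - \<nu> / 2 * (norm x)\<^sup>2)"

definition lipschitz_smooth :: "real \<Rightarrow> ('a::real_inner \<Rightarrow> real) \<Rightarrow> bool" where
  "lipschitz_smooth K \<phi> \<longleftrightarrow> (\<exists>G. (\<forall>x. GDERIV \<phi> x :> G x) \<and> K-lipschitz_on UNIV G)"

text \<open>The conjugate of a real-valued function may take the value \<open>\<infinity>\<close>, hence \<^typ>\<open>ereal\<close>.\<close>

definition convex_conjugate :: "('a::real_inner \<Rightarrow> real) \<Rightarrow> 'a \<Rightarrow> ereal" where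
  "convex_conjugate f y = (SUP z. ereal (y \<bullet> z - f z))"

definition prox :: "real \<Rightarrow> ('a::real_inner \<Rightarrow> ereal) \<Rightarrow> 'a \<Rightarrow> 'a" where
  "prox s \<psi> z = (ARG_MIN (\<lambda>x. ereal s * \<psi> x + ereal (1 / 2 * (norm (x - z))\<^sup>2)) x. True)"

definition real_eigenvalues :: "real ^ 'm ^ 'm \<Rightarrow> real set" where
  "real_eigenvalues M = {l. \<exists>v. v \<noteq> 0 \<and> M *v v = l *\<^sub>R v}"

text \<open>The extreme eigenvalues are meant for symmetric \<open>M\<close>, where \<open>real_eigenvalues M\<close> is the
  whole spectrum, finite and nonempty.\<close>

definition lambda_min :: "real ^ 'm ^ 'm \<Rightarrow> real" where
  "lambda_min M = Min (real_eigenvalues M)"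

definition lambda_max :: "real ^ 'm ^ 'm \<Rightarrow> real" where
  "lambda_max M = Max (real_eigenvalues M)"

definition spectral_norm :: "real ^ 'd ^ 'n \<Rightarrow> real" where
  "spectral_norm A = onorm (\<lambda>x. A *v x)"

text \<open>Since \<open>f\<close> and \<open>g\<close> are real-valued, the conjugate is never \<open>-\<infinity>\<close> and the difference below
  never has the form \<open>\<infinity> - \<infinity>\<close>; the Lagrangian is \<open>-\<infinity>\<close> exactly when \<open>y\<close> lies outside the domain
  of the conjugate of \<open>f\<close>.\<close>

definition lagrangian ::
  "real ^ 'd ^ 'n \<Rightarrow> (real ^ 'n \<Rightarrow> real) \<Rightarrow> (real ^ 'd \<Rightarrow> real) \<Rightarrow> real ^ 'd \<Rightarrow> real ^ 'n \<Rightarrow> ereal" where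
  "lagrangian A f g x y = ereal (g x + y \<bullet> (A *v x)) - convex_conjugate f y"

definition saddle_point :: "('a \<Rightarrow> 'b \<Rightarrow> ereal) \<Rightarrow> 'a \<times> 'b \<Rightarrow> bool" where
  "saddle_point F = (\<lambda>(x, y). (\<forall>y'. F x y' \<le> F x y) \<and> (\<forall>x'. F x y \<le> F x' y))"

definition bpd_iterates ::
  "real ^ 'd ^ 'n \<Rightarrow> (real ^ 'n \<Rightarrow> real) \<Rightarrow> (real ^ 'd \<Rightarrow> real) \<Rightarrow> real \<Rightarrow> real \<Rightarrow> real \<Rightarrow>
    (nat \<Rightarrow> real ^ 'd) \<Rightarrow> (nat \<Rightarrow> real ^ 'n) \<Rightarrow> bool" where
  "bpd_iterates A f g \<tau> \<sigma> \<theta> x y \<longleftrightarrow>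
    (\<exists>x'. x' 0 = x 0 \<and>
      (\<forall>t. y (Suc t) = prox \<sigma> (convex_conjugate f) (y t + \<sigma> *\<^sub>R (A *v x' t)) \<and>
           x (Suc t) = prox \<tau> (\<lambda>z. ereal (g z)) (x t - \<tau> *\<^sub>R (transpose A *v y (Suc t))) \<and>
           x' (Suc t) = x (Suc t) + \<theta> *\<^sub>R (x (Suc t) - x t)))"

lemma finite_real_eigenvalues_symmetric:
  fixes M :: "real ^ 'm ^ 'm"
  assumes sym: "transpose M = M"
  shows "finite (real_eigenvalues M)"
proof -
  obtain e where e: "\<And>l. l \<in> real_eigenvalues M \<Longrightarrow> e l \<noteq> 0 \<and> M *v e l = l *\<^sub>R e l"
    unfolding real_eigenvalues_def by (atomize_elim, rule choice) auto
  have orth: "e a \<bullet> e b = 0"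
    if a: "a \<in> real_eigenvalues M" and b: "b \<in> real_eigenvalues M" and "a \<noteq> b" for a b
  proof -
    have "(M *v e a) \<bullet> e b = e a \<bullet> (M *v e b)"
      using dot_lmul_matrix[of "e a" M "e b"] sym by (metis transpose_matrix_vector)
    then have "(a - b) * (e a \<bullet> e b) = 0"
      using e[OF a] e[OF b] by (simp add: algebra_simps)
    then show ?thesis using \<open>a \<noteq> b\<close> by simp
  qed
  have inj: "inj_on e (real_eigenvalues M)"
    by (rule inj_onI) (metis e orth inner_eq_zero_iff)
  have "pairwise orthogonal (e ` real_eigenvalues M)"
    using orth by (auto simp: pairwise_def orthogonal_def)
  then have "independent (e ` real_eigenvalues M)"
    using pairwise_orthogonal_independent e by fastforce
  then have "finite (e ` real_eigenvalues M)"
    using independent_imp_finite by blast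
  then show ?thesis using inj finite_imageD by blast
qed

lemma spectral_norm_eq_sqrt_lambda_max:
  fixes A :: "real ^ 'd ^ 'n"
  shows "spectral_norm A = sqrt (lambda_max (transpose A ** A))"
proof -
  define M where "M = transpose A ** A"
  define s where "s = spectral_norm A"
  have M: "M *v v = transpose A *v (A *v v)" for v
    by (simp add: M_def matrix_vector_mul_assoc)
  have adj: "(transpose A *v w) \<bullet> v = w \<bullet> (A *v v)" for v w
    using dot_lmul_matrix[of w A v] by simp
  have bl: "bounded_linear (\<lambda>x. A *v x)" by simp
  have le: "norm (A *v v) \<le> s * norm v" for v
    unfolding s_def spectral_norm_def using onorm[OF bl] by blast
  have s0: "0 \<le> s"
    unfolding s_def spectral_norm_def by (rule onorm_pos_le[OF bl])
  have leT: "norm (transpose A *v w) \<le> s * norm w" for w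
  proof -
    define u where "u = transpose A *v w"
    have "norm u * norm u = w \<bullet> (A *v u)"
      by (simp add: u_def flip: adj power2_eq_square power2_norm_eq_inner)
    also have "\<dots> \<le> norm w * norm (A *v u)" by (rule norm_cauchy_schwarz)
    also have "\<dots> \<le> norm w * (s * norm u)" by (intro mult_left_mono le) simp
    finally have "norm u * norm u \<le> (s * norm w) * norm u" by (simp add: algebra_simps)
    then show ?thesis unfolding u_def[symmetric] using s0
      by (cases "norm u = 0") (auto simp: mult_le_cancel_right)
  qed
  have "\<exists>v\<in>sphere 0 1. \<forall>w\<in>sphere 0 1. norm (A *v w) \<le> norm (A *v (v :: real ^ 'd))"
    by (intro continuous_attains_sup continuous_intros) auto
  then obtain v where v: "norm v = 1" "\<And>w. norm w = 1 \<Longrightarrow> norm (A *v w) \<le> norm (A *v v)"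
    by auto
  have "s \<le> norm (A *v v)"
    unfolding s_def spectral_norm_def
  proof (rule onorm_le)
    fix x
    show "norm (A *v x) \<le> norm (A *v v) * norm x"
    proof (cases "x = 0")
      case False
      then show ?thesis
        using v(2)[of "(1 / norm x) *\<^sub>R x"] by (simp add: matrix_vector_mult_scaleR field_simps)
    qed simp
  qed
  then have sv: "norm (A *v v) = s" using le[of v] v(1) by simp
  have "(norm (M *v v - s\<^sup>2 *\<^sub>R v))\<^sup>2 = (norm (M *v v))\<^sup>2 - 2 * s\<^sup>2 * ((M *v v) \<bullet> v) + (s\<^sup>2)\<^sup>2"
    using v(1) dot_norm_neg[of "M *v v" "s\<^sup>2 *\<^sub>R v"] by (simp add: power_mult_distrib field_simps)
  also have "(M *v v) \<bullet> v = s\<^sup>2"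
    by (simp add: M dot_lmul_matrix sv flip: power2_norm_eq_inner)
  also have "(norm (M *v v))\<^sup>2 \<le> (s * s)\<^sup>2"
    using leT[of "A *v v"] by (intro power_mono) (simp_all add: M sv)
  finally have "(norm (M *v v - s\<^sup>2 *\<^sub>R v))\<^sup>2 \<le> 0" by (simp add: power2_eq_square)
  then have "M *v v = s\<^sup>2 *\<^sub>R v" by simp
  then have mem: "s\<^sup>2 \<in> real_eigenvalues M"
    using v(1) unfolding real_eigenvalues_def by (intro CollectI exI[of _ v]) auto
  have ub: "l \<le> s\<^sup>2" if l: "l \<in> real_eigenvalues M" for l
  proof -
    obtain w where w: "w \<noteq> 0" "M *v w = l *\<^sub>R w"
      using l unfolding real_eigenvalues_def by auto
    have "l * (norm w)\<^sup>2 = (M *v w) \<bullet> w" by (simp add: w power2_norm_eq_inner)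
    also have "\<dots> = (norm (A *v w))\<^sup>2" by (simp add: M dot_lmul_matrix power2_norm_eq_inner)
    also have "\<dots> \<le> (s * norm w)\<^sup>2" by (intro power_mono le) simp
    finally show ?thesis using w(1) by (simp add: power_mult_distrib)
  qed
  have "finite (real_eigenvalues M)"
    by (rule finite_real_eigenvalues_symmetric) (simp add: M_def matrix_transpose_mul)
  then have "lambda_max M = s\<^sup>2"
    unfolding lambda_max_def using mem ub by (intro Max_eqI) auto
  then show ?thesis using s0 by (simp add: M_def s_def)
qed

end

theory Submission
  imports Defs
begin

text \<open>Write \<open>y\<^sup>t\<^sup>+\<^sup>1 = \<nabla>f(z)\<close> and \<open>u = z - Ax\<^sup>\<star>\<close>, where \<open>y\<^sup>\<star> = \<nabla>f(Ax\<^sup>\<star>)\<close>. Averaging strong convexity and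
  cocoercivity of \<open>f\<close> yields, besides \<open>\<gamma>/4 |y\<^sup>t\<^sup>+\<^sup>1 - y\<^sup>\<star>|\<^sup>2\<close>, a surplus \<open>\<delta>/4 |u|\<^sup>2\<close>. The dual step reads
  \<open>u = a + \<theta>b - D\<close> with \<open>a = A(x\<^sup>t - x\<^sup>\<star>)\<close>, \<open>b = A(x\<^sup>t - x\<^sup>t\<^sup>-\<^sup>1)\<close>, \<open>D = (y\<^sup>t\<^sup>+\<^sup>1 - y\<^sup>t)/\<sigma>\<close>, and the quadratic terms
  that the standard analysis discards amount to at least \<open>\<sigma>/2 |D - \<theta>b|\<^sup>2 = \<sigma>/2 |a - u|\<^sup>2\<close>. Minimizing
  \<open>\<delta>/4 |u|\<^sup>2 + \<sigma>/2 |a - u|\<^sup>2\<close> over \<open>u\<close> leaves \<open>\<delta>\<sigma>/(2(\<delta> + 2\<sigma>)) |a|\<^sup>2\<close>, which is at least that multiple of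
  \<open>\<mu>\<^sup>2 |x\<^sup>t - x\<^sup>\<star>|\<^sup>2\<close>: this is the contraction of the primal distance encoded in \<open>\<theta>\<^sub>x\<close>, and it is
  available even when \<open>g\<close> is not strongly convex.\<close>

section \<open>Strong convexity: inequality on segments, growth at a minimizer, existence of
  minimizers\<close>

lemma norm_segment_point_squared:
  fixes a b z :: "'a::real_inner"
  shows "(norm (a + s *\<^sub>R (b - a) - z))\<^sup>2
    = (1 - s) * (norm (a - z))\<^sup>2 + s * (norm (b - z))\<^sup>2 - s * (1 - s) * (norm (b - a))\<^sup>2"
  by (simp add: power2_norm_eq_inner inner_simps inner_commute algebra_simps)

text \<open>Subtracting the quadratic shifts the convexity inequality by exactly the defect computed
  in \<open>norm_segment_point_squared\<close> at \<open>z = 0\<close>. The segment form involves no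
  derivative, so it also serves \<open>g\<close>, which may be nonsmooth.\<close>

lemma strongly_convex_iff:
  "strongly_convex m \<phi> \<longleftrightarrow> (\<forall>a b s. 0 \<le> s \<and> s \<le> 1 \<longrightarrow>
    \<phi> (a + s *\<^sub>R (b - a)) \<le> (1 - s) * \<phi> a + s * \<phi> b - m / 2 * (s * (1 - s)) * (norm (b - a))\<^sup>2)"
proof -
  have seg: "(1 - s) *\<^sub>R a + s *\<^sub>R b = a + s *\<^sub>R (b - a)" for a b :: 'a and s
    by (simp add: algebra_simps)
  define h where "h x = \<phi> x - m / 2 * (norm x)\<^sup>2" for x
  have "h ((1 - s) *\<^sub>R a + s *\<^sub>R b) \<le> (1 - s) * h a + s * h b \<longleftrightarrow>
    \<phi> (a + s *\<^sub>R (b - a)) \<le> (1 - s) * \<phi> a + s * \<phi> b - m / 2 * (s * (1 - s)) * (norm (b - a))\<^sup>2" for a b s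
    unfolding h_def seg norm_segment_point_squared[of a s b 0, simplified]
    by (simp add: algebra_simps add_divide_distrib diff_divide_distrib)
  moreover have "strongly_convex m \<phi> \<longleftrightarrow> convex_on UNIV h"
    unfolding strongly_convex_def h_def ..
  moreover have "convex_on UNIV h \<longleftrightarrow>
      (\<forall>a b s. 0 \<le> s \<and> s \<le> 1 \<longrightarrow> h ((1 - s) *\<^sub>R a + s *\<^sub>R b) \<le> (1 - s) * h a + s * h b)"
    by (auto intro!: convex_onI dest: convex_onD)
  ultimately show ?thesis
    by simp
qed

lemmas strongly_convex_ineq = strongly_convex_iff[THEN iffD1, rule_format, OF _ conjI]

text \<open>Let \<open>s\<close> tend to 0 from the right. This replaces directional derivatives
  when a minimizer is compared with nearby points of a segment.\<close>

lemma le_of_le_add_mult_small: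
  fixes a b c :: real
  assumes "\<And>s. 0 < s \<Longrightarrow> s \<le> 1 \<Longrightarrow> a \<le> b + s * c"
  shows "a \<le> b"
proof (rule tendsto_lowerbound)
  show "((\<lambda>s. b + s * c) \<longlongrightarrow> b) (at_right 0)"
    by (auto intro!: tendsto_eq_intros)
  show "\<forall>\<^sub>F s in at_right 0. a \<le> b + s * c"
    unfolding eventually_at_right_field using assms by (auto intro!: exI[of _ 1])
qed simp

text \<open>Compare \<open>p\<close> with the point at parameter \<open>s\<close> on the segment to
  \<open>x\<close>, divide by \<open>s\<close> and let \<open>s\<close> vanish: only the strong
  convexity defect survives.\<close>

lemma strongly_convex_growth:
  assumes sc: "strongly_convex m \<phi>" and min: "\<And>x. \<phi> p \<le> \<phi> x"
  shows "\<phi> p + m / 2 * (norm (x - p))\<^sup>2 \<le> \<phi> x"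
proof (rule le_of_le_add_mult_small)
  fix s :: real
  assume s: "0 < s" "s \<le> 1"
  have "\<phi> p \<le> (1 - s) * \<phi> p + s * \<phi> x - m / 2 * (s * (1 - s)) * (norm (x - p))\<^sup>2"
    using strongly_convex_ineq[OF sc, of s p x] min[of "p + s *\<^sub>R (x - p)"] s by linarith
  then have "s * (\<phi> p + m / 2 * (norm (x - p))\<^sup>2) \<le> s * (\<phi> x + s * (m / 2 * (norm (x - p))\<^sup>2))"
    by (simp add: algebra_simps add_divide_distrib diff_divide_distrib)
  then show "\<phi> p + m / 2 * (norm (x - p))\<^sup>2 \<le> \<phi> x + s * (m / 2 * (norm (x - p))\<^sup>2)"
    using s by simp
qed

text \<open>The convex part \<open>h\<close> falls at most linearly, so the quadratic term dominates
  far away. A minimizer over a large ball, which exists by compactness, is therefore global.\<close>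

lemma strongly_convex_has_min:
  fixes \<phi> :: "'a::euclidean_space \<Rightarrow> real"
  assumes sc: "strongly_convex m \<phi>" and m: "0 < m"
  shows "\<exists>p. \<forall>x. \<phi> p \<le> \<phi> x"
proof -
  define h where "h x = \<phi> x - m / 2 * (norm x)\<^sup>2" for x
  have cvx: "convex_on UNIV h"
    using sc unfolding strongly_convex_def h_def .
  have cont_h: "continuous_on UNIV h"
    using convex_on_continuous[OF open_UNIV cvx] .
  have cont: "continuous_on UNIV \<phi>"
  proof -
    have "\<phi> = (\<lambda>x. h x + m / 2 * (norm x)\<^sup>2)"
      by (simp add: h_def)
    then show ?thesis
      using cont_h by (auto intro!: continuous_intros)
  qed
  obtain q where q: "\<And>x. norm x \<le> 1 \<Longrightarrow> h q \<le> h x"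
    using continuous_attains_inf[of "cball 0 1" h] continuous_on_subset[OF cont_h subset_UNIV, of "cball 0 1"]
    by (auto simp: Ball_def)
  define K where "K = h 0 - h q"
  have K: "0 \<le> K"
    using q[of 0] by (simp add: K_def)
  \<comment> \<open>Convexity between 0 and \<open>x\<close>, evaluated where the segment meets the
    unit sphere: there \<open>h\<close> is at least \<open>h q\<close>, which limits the rate of
    descent to \<open>K\<close>.\<close>
  have lower: "h 0 - K * norm x \<le> h x" if x: "1 \<le> norm x" for x
  proof -
    have "h ((1 - 1 / norm x) *\<^sub>R 0 + (1 / norm x) *\<^sub>R x) \<le> (1 - 1 / norm x) * h 0 + 1 / norm x * h x"
      using x by (intro convex_onD[OF cvx]) (auto simp: divide_le_eq)
    moreover have "h q \<le> h ((1 / norm x) *\<^sub>R x)"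
      using x by (intro q) auto
    ultimately have "h q \<le> (1 - 1 / norm x) * h 0 + 1 / norm x * h x"
      by simp
    then have "norm x * h q \<le> norm x * ((1 - 1 / norm x) * h 0 + 1 / norm x * h x)"
      by (intro mult_left_mono) auto
    also have "\<dots> = (norm x - 1) * h 0 + h x"
      using x by (auto simp: field_simps)
    finally show ?thesis
      by (simp add: K_def algebra_simps)
  qed
  \<comment> \<open>Beyond radius 2K/m the gain m/2 |x|^2 exceeds the loss K |x|; the maximum with 1
    makes \<open>lower\<close> applicable.\<close>
  define R where "R = max 1 (2 * K / m)"
  have "\<exists>p\<in>cball 0 R. \<forall>x\<in>cball 0 R. \<phi> p \<le> \<phi> x"
    using continuous_on_subset[OF cont] by (intro continuous_attains_inf) (auto simp: R_def)
  then obtain p where p: "\<And>x. norm x \<le> R \<Longrightarrow> \<phi> p \<le> \<phi> x"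
    by (auto simp: Ball_def)
  have "\<phi> p \<le> \<phi> x" for x
  proof (cases "norm x \<le> R")
    case False
    then have x: "1 \<le> norm x" "2 * K / m \<le> norm x"
      by (auto simp: R_def)
    have "K \<le> m / 2 * norm x"
      using x(2) m by (simp add: field_simps)
    then have "K * norm x \<le> m / 2 * norm x * norm x"
      by (intro mult_right_mono) auto
    then have "\<phi> 0 \<le> \<phi> x"
      using lower[OF x(1)] by (simp add: h_def power2_eq_square)
    moreover have "\<phi> p \<le> \<phi> 0"
      by (rule p) (simp add: R_def)
    ultimately show ?thesis
      by simp
  qed (rule p)
  then show ?thesis by blast
qed

lemma strongly_convex_add_quadratic:
  assumes sc: "strongly_convex m \<phi>" and "0 \<le> a"
  shows "strongly_convex (a * m + b) (\<lambda>x. a * \<phi> x + b / 2 * (norm (x - z))\<^sup>2)"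
proof (unfold strongly_convex_iff, intro allI impI, elim conjE)
  fix u v :: 'a and s :: real
  assume s: "0 \<le> s" "s \<le> 1"
  have "a * \<phi> (u + s *\<^sub>R (v - u))
      \<le> a * ((1 - s) * \<phi> u + s * \<phi> v - m / 2 * (s * (1 - s)) * (norm (v - u))\<^sup>2)"
    using strongly_convex_ineq[OF sc s] \<open>0 \<le> a\<close> by (intro mult_left_mono)
  then show "a * \<phi> (u + s *\<^sub>R (v - u)) + b / 2 * (norm (u + s *\<^sub>R (v - u) - z))\<^sup>2
      \<le> (1 - s) * (a * \<phi> u + b / 2 * (norm (u - z))\<^sup>2) + s * (a * \<phi> v + b / 2 * (norm (v - z))\<^sup>2)
        - (a * m + b) / 2 * (s * (1 - s)) * (norm (v - u))\<^sup>2"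
    unfolding norm_segment_point_squared
    by (simp add: algebra_simps add_divide_distrib diff_divide_distrib)
qed

section \<open>Gradient inequalities for smooth and strongly convex functions\<close>

text \<open>Testing with \<open>d = - (1 / c) *\<^sub>R p\<close>, the minimizer of the quadratic,
  gives a negative value unless \<open>p\<close> vanishes. It turns minimality together with a
  quadratic upper model into a first-order condition.\<close>

lemma zero_if_quadratic_nonneg:
  fixes p :: "'a::real_inner"
  assumes "0 < c" and "\<And>d. 0 \<le> p \<bullet> d + c / 2 * (norm d)\<^sup>2"
  shows "p = 0"
proof -
  have "0 \<le> p \<bullet> (- (1 / c) *\<^sub>R p) + c / 2 * (norm (- (1 / c) *\<^sub>R p))\<^sup>2"
    by (rule assms)
  also have "\<dots> = - (norm p)\<^sup>2 / (2 * c)"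
    using \<open>0 < c\<close> by (simp add: power2_eq_square field_simps flip: power2_norm_eq_inner)
  finally show ?thesis
    using \<open>0 < c\<close> by (simp add: field_simps)
qed

lemma GDERIV_along_line:
  assumes "\<And>x. GDERIV f x :> G x"
  shows "((\<lambda>s. f (z + s *\<^sub>R d)) has_real_derivative G (z + s *\<^sub>R d) \<bullet> d) (at s)"
proof -
  have "(f has_derivative (\<lambda>h. h \<bullet> G (z + s *\<^sub>R d))) (at (z + s *\<^sub>R d))"
    using assms unfolding gderiv_def .
  moreover have "((\<lambda>s. z + s *\<^sub>R d) has_derivative (\<lambda>h. h *\<^sub>R d)) (at s)"
    by (auto intro!: derivative_eq_intros)
  ultimately have "((\<lambda>s. f (z + s *\<^sub>R d)) has_derivative (\<lambda>h. (h *\<^sub>R d) \<bullet> G (z + s *\<^sub>R d))) (at s)"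
    by (rule has_derivative_compose[rotated])
  then show ?thesis
    unfolding has_field_derivative_def
    by (rule has_derivative_eq_rhs) (auto simp: inner_commute mult.commute)
qed

text \<open>Along the segment, \<open>f\<close> minus its quadratic model has derivative at most 0,
  by Cauchy-Schwarz and the Lipschitz bound on \<open>G\<close>.\<close>

lemma smooth_upper_bound:
  assumes G: "\<And>x. GDERIV f x :> G x" and lip: "K-lipschitz_on UNIV G"
  shows "f (z + d) \<le> f z + G z \<bullet> d + K / 2 * (norm d)\<^sup>2"
proof -
  define \<psi> where "\<psi> s = f (z + s *\<^sub>R d) - s * (G z \<bullet> d) - K / 2 * s\<^sup>2 * (norm d)\<^sup>2" for s
  have "\<psi> 1 \<le> \<psi> 0"
  proof (rule DERIV_nonpos_imp_nonincreasing[where f = \<psi>])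
    fix s :: real
    assume s: "0 \<le> s" "s \<le> 1"
    have "(\<psi> has_real_derivative G (z + s *\<^sub>R d) \<bullet> d - G z \<bullet> d - K * s * (norm d)\<^sup>2) (at s)"
      unfolding \<psi>_def by (auto intro!: derivative_eq_intros GDERIV_along_line[OF G])
    moreover have "G (z + s *\<^sub>R d) \<bullet> d - G z \<bullet> d \<le> K * s * (norm d)\<^sup>2"
    proof -
      have "(G (z + s *\<^sub>R d) - G z) \<bullet> d \<le> norm (G (z + s *\<^sub>R d) - G z) * norm d"
        by (rule norm_cauchy_schwarz)
      also have "\<dots> \<le> (K * norm (s *\<^sub>R d)) * norm d"
        using lipschitz_onD[OF lip, of "z + s *\<^sub>R d" z]
        by (intro mult_right_mono) (auto simp: dist_norm)
      finally show ?thesis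
        using s by (simp add: inner_diff_left power2_eq_square algebra_simps)
    qed
    ultimately show "\<exists>y. (\<psi> has_real_derivative y) (at s) \<and> y \<le> 0"
      by force
  qed simp
  then show ?thesis
    by (simp add: \<psi>_def)
qed

text \<open>The segment inequality bounds the difference quotient at \<open>z\<close> towards
  \<open>w\<close>; the limit \<open>s\<close> to 0 from the right gives the gradient term.\<close>

lemma strongly_convex_gradient_lower_bound:
  assumes G: "\<And>x. GDERIV f x :> G x" and sc: "strongly_convex m f"
  shows "f z + G z \<bullet> (w - z) + m / 2 * (norm (w - z))\<^sup>2 \<le> f w"
proof -
  have "((\<lambda>s. f (z + s *\<^sub>R (w - z))) has_real_derivative G (z + 0 *\<^sub>R (w - z)) \<bullet> (w - z)) (at 0)"
    by (rule GDERIV_along_line[OF G])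
  then have "((\<lambda>s. (f (z + s *\<^sub>R (w - z)) - f z) / s) \<longlongrightarrow> G z \<bullet> (w - z)) (at_right 0)"
    unfolding DERIV_def by (auto intro: tendsto_within_subset)
  moreover have "((\<lambda>s. f w - f z - m / 2 * (1 - s) * (norm (w - z))\<^sup>2)
      \<longlongrightarrow> f w - f z - m / 2 * (norm (w - z))\<^sup>2) (at_right (0 :: real))"
    by (auto intro!: tendsto_eq_intros)
  moreover have "\<forall>\<^sub>F s in at_right 0. (f (z + s *\<^sub>R (w - z)) - f z) / s
      \<le> f w - f z - m / 2 * (1 - s) * (norm (w - z))\<^sup>2"
    unfolding eventually_at_right_field
  proof (intro exI[of _ 1] conjI allI impI)
    fix s :: real
    assume "0 < s" "s < 1"
    then show "(f (z + s *\<^sub>R (w - z)) - f z) / s \<le> f w - f z - m / 2 * (1 - s) * (norm (w - z))\<^sup>2"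
      using strongly_convex_ineq[OF sc, of s z w] by (simp add: field_simps)
  qed simp
  ultimately have "G z \<bullet> (w - z) \<le> f w - f z - m / 2 * (norm (w - z))\<^sup>2"
    by (intro tendsto_le[of "at_right 0"]) auto
  then show ?thesis
    by simp
qed

lemma smooth_convex_cocoercive:
  assumes G: "\<And>x. GDERIV f x :> G x" and lip: "(1 / \<gamma>)-lipschitz_on UNIV G"
    and cvx: "strongly_convex 0 f" and \<gamma>: "0 < \<gamma>"
  shows "f u + G u \<bullet> (z - u) + \<gamma> / 2 * (norm (G z - G u))\<^sup>2 \<le> f z"
proof -
  \<comment> \<open>A gradient step of length \<gamma> from \<open>z\<close> for f tilted by the
    linear function with slope \<open>G u\<close>. The tilted function is minimal at
    \<open>u\<close>, so the decrease guaranteed by the upper model bounds its value at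
    \<open>z\<close> from below.\<close>
  define d where "d = - \<gamma> *\<^sub>R (G z - G u)"
  have "f u + G u \<bullet> (z + d - u) \<le> f (z + d)"
    using strongly_convex_gradient_lower_bound[OF G cvx, of u "z + d"] by simp
  also have "\<dots> \<le> f z + G z \<bullet> d + 1 / \<gamma> / 2 * (norm d)\<^sup>2"
    by (rule smooth_upper_bound[OF G lip])
  finally have "f u + G u \<bullet> (z - u) \<le> f z + (G z - G u) \<bullet> d + 1 / \<gamma> / 2 * (norm d)\<^sup>2"
    by (simp add: inner_simps)
  moreover have "(G z - G u) \<bullet> d + 1 / \<gamma> / 2 * (norm d)\<^sup>2 = - \<gamma> / 2 * (norm (G z - G u))\<^sup>2"
    using \<gamma> by (simp add: d_def power_mult_distrib power2_norm_eq_inner[of "G z - G u"])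
      (simp add: field_simps power2_eq_square)
  ultimately show ?thesis
    by linarith
qed

lemma subgradient_eq_gradient:
  assumes G: "\<And>x. GDERIV f x :> G x" and lip: "K-lipschitz_on UNIV G" and "0 < K"
    and sub: "\<And>w. y \<bullet> w - f w \<le> y \<bullet> z - f z"
  shows "y = G z"
proof -
  have "G z - y = 0"
  proof (rule zero_if_quadratic_nonneg[OF \<open>0 < K\<close>])
    fix d
    show "0 \<le> (G z - y) \<bullet> d + K / 2 * (norm d)\<^sup>2"
      using smooth_upper_bound[OF G lip, of z d] sub[of "z + d"] by (simp add: inner_simps)
  qed
  then show ?thesis by simp
qed

section \<open>The conjugate and proximal points\<close>

lemma convex_conjugate_ge: "ereal (y \<bullet> z - f z) \<le> convex_conjugate f y"
  unfolding convex_conjugate_def by (rule SUP_upper) simp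

text \<open>Equality case of Fenchel-Young. At gradients of \<open>f\<close> the conjugate is finite
  and explicit, so Lagrangian values there reduce to real arithmetic.\<close>

lemma convex_conjugate_gradient:
  assumes G: "\<And>x. GDERIV f x :> G x" and cvx: "strongly_convex 0 f"
  shows "convex_conjugate f (G z) = ereal (G z \<bullet> z - f z)"
proof (rule antisym)
  show "convex_conjugate f (G z) \<le> ereal (G z \<bullet> z - f z)"
    unfolding convex_conjugate_def
  proof (rule SUP_least)
    fix w
    show "ereal (G z \<bullet> w - f w) \<le> ereal (G z \<bullet> z - f z)"
      using strongly_convex_gradient_lower_bound[OF G cvx, of z w] by (simp add: inner_simps)
  qed
qed (rule convex_conjugate_ge)

text \<open>\<open>prox\<close> picks some minimizer by choice; the strict inequality makes
  \<open>p\<close> the only candidate.\<close>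

lemma prox_eqI:
  assumes "\<And>x. x \<noteq> p \<Longrightarrow> ereal s * \<psi> p + ereal (1 / 2 * (norm (p - z))\<^sup>2)
      < ereal s * \<psi> x + ereal (1 / 2 * (norm (x - z))\<^sup>2)"
  shows "prox s \<psi> z = p"
proof -
  let ?F = "\<lambda>x. ereal s * \<psi> x + ereal (1 / 2 * (norm (x - z))\<^sup>2)"
  have "?F (arg_min ?F (\<lambda>_. True)) = ?F p"
    by (rule arg_min_equality) (use assms in \<open>auto intro: less_imp_le\<close>, metis order.refl less_imp_le)
  then show ?thesis
    unfolding prox_def using assms[of "arg_min ?F (\<lambda>_. True)"] by fastforce
qed

text \<open>Moreau decomposition: the proximal point of \<open>\<sigma> f\<^sup>*\<close> at \<open>w\<close> is the gradient of \<open>f\<close> at the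
  proximal point \<open>z\<close> of \<open>f / \<sigma>\<close> at \<open>w / \<sigma>\<close>. Working with \<open>z\<close> avoids gradients of the conjugate,
  which need not exist when \<open>\<delta> = 0\<close>.\<close>

lemma prox_convex_conjugate:
  fixes f :: "'a::euclidean_space \<Rightarrow> real"
  assumes G: "\<And>x. GDERIV f x :> G x" and lip: "K-lipschitz_on UNIV G" and K: "0 < K"
    and cvx: "strongly_convex 0 f" and \<sigma>: "0 < \<sigma>"
  shows "\<exists>z. prox \<sigma> (convex_conjugate f) w = G z \<and> G z = w - \<sigma> *\<^sub>R z"
proof -
  let ?F = "\<lambda>x. 1 * f x + \<sigma> / 2 * (norm (x - (1 / \<sigma>) *\<^sub>R w))\<^sup>2"
  have "strongly_convex (1 * 0 + \<sigma>) ?F"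
    by (rule strongly_convex_add_quadratic[OF cvx]) simp
  then obtain z where z: "\<And>x. ?F z \<le> ?F x"
    using strongly_convex_has_min[of "1 * 0 + \<sigma>" ?F] \<sigma> by auto
  have "G z + \<sigma> *\<^sub>R z - w = 0"
  proof (rule zero_if_quadratic_nonneg)
    show "0 < K + \<sigma>"
      using K \<sigma> by simp
    fix d
    have "(norm (z + d - (1 / \<sigma>) *\<^sub>R w))\<^sup>2
        = (norm (z - (1 / \<sigma>) *\<^sub>R w))\<^sup>2 + 2 * (z \<bullet> d - 1 / \<sigma> * (w \<bullet> d)) + (norm d)\<^sup>2"
      by (simp add: power2_norm_eq_inner inner_simps inner_commute algebra_simps)
    then have "\<sigma> / 2 * (norm (z + d - (1 / \<sigma>) *\<^sub>R w))\<^sup>2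
        = \<sigma> / 2 * (norm (z - (1 / \<sigma>) *\<^sub>R w))\<^sup>2 + \<sigma> * (z \<bullet> d) - w \<bullet> d + \<sigma> / 2 * (norm d)\<^sup>2"
      using \<sigma> by (simp add: field_simps)
    then show "0 \<le> (G z + \<sigma> *\<^sub>R z - w) \<bullet> d + (K + \<sigma>) / 2 * (norm d)\<^sup>2"
      using z[of "z + d"] smooth_upper_bound[OF G lip, of z d]
      by (simp add: inner_simps algebra_simps add_divide_distrib)
  qed
  then have Gz: "G z = w - \<sigma> *\<^sub>R z"
    by (simp add: algebra_simps)
  moreover have "prox \<sigma> (convex_conjugate f) w = G z"
  proof (rule prox_eqI)
    fix v
    assume v: "v \<noteq> G z"
    \<comment> \<open>Since \<open>G z - w\<close> equals \<open>- \<sigma> *\<^sub>R z\<close>, the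
      linear term cancels against the increase of the affine minorant
      \<open>v \<bullet> z - f z\<close> of the conjugate; the remaining square gives
      strictness.\<close>
    have "(norm (v - w))\<^sup>2 = (norm (G z - w))\<^sup>2 - 2 * \<sigma> * ((v - G z) \<bullet> z) + (norm (v - G z))\<^sup>2"
      unfolding Gz by (simp add: power2_norm_eq_inner inner_simps inner_commute algebra_simps)
        (simp add: power2_eq_square)
    moreover have "0 < (norm (v - G z))\<^sup>2"
      using v by simp
    ultimately have "\<sigma> * (G z \<bullet> z - f z) + 1 / 2 * (norm (G z - w))\<^sup>2
        < \<sigma> * (v \<bullet> z - f z) + 1 / 2 * (norm (v - w))\<^sup>2"
      unfolding inner_diff_left right_diff_distrib by linarith
    then have "ereal \<sigma> * convex_conjugate f (G z) + ereal (1 / 2 * (norm (G z - w))\<^sup>2)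
        < ereal \<sigma> * ereal (v \<bullet> z - f z) + ereal (1 / 2 * (norm (v - w))\<^sup>2)"
      by (simp add: convex_conjugate_gradient[OF G cvx])
    also have "\<dots> \<le> ereal \<sigma> * convex_conjugate f v + ereal (1 / 2 * (norm (v - w))\<^sup>2)"
      using \<sigma> by (intro add_right_mono ereal_mult_left_mono convex_conjugate_ge) simp
    finally show "ereal \<sigma> * convex_conjugate f (G z) + ereal (1 / 2 * (norm (G z - w))\<^sup>2)
        < ereal \<sigma> * convex_conjugate f v + ereal (1 / 2 * (norm (v - w))\<^sup>2)" .
  qed
  ultimately show ?thesis
    by blast
qed

text \<open>The proximal objective is strongly convex with modulus \<open>\<tau> * m + 1\<close>, so
  quadratic growth holds at its minimizer.\<close>

lemma prox_strongly_convex: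
  fixes g :: "'a::euclidean_space \<Rightarrow> real"
  assumes sc: "strongly_convex m g" and "0 \<le> m" and \<tau>: "0 < \<tau>"
    and p: "p = prox \<tau> (\<lambda>x. ereal (g x)) z"
  shows "\<tau> * g p + 1 / 2 * (norm (p - z))\<^sup>2 + (\<tau> * m + 1) / 2 * (norm (u - p))\<^sup>2
    \<le> \<tau> * g u + 1 / 2 * (norm (u - z))\<^sup>2"
proof -
  let ?F = "\<lambda>x. \<tau> * g x + 1 / 2 * (norm (x - z))\<^sup>2"
  have pos: "0 < \<tau> * m + 1"
    using \<tau> \<open>0 \<le> m\<close> by (simp add: add_nonneg_pos)
  have F: "strongly_convex (\<tau> * m + 1) ?F"
    using \<tau> by (intro strongly_convex_add_quadratic[OF sc]) simp
  obtain q where q: "\<And>x. ?F q \<le> ?F x"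
    using strongly_convex_has_min[OF F pos] by blast
  note growth = strongly_convex_growth[OF F q]
  have "p = q"
    unfolding p
  proof (rule prox_eqI)
    fix x
    assume "x \<noteq> q"
    then have "0 < (\<tau> * m + 1) / 2 * (norm (x - q))\<^sup>2"
      using pos by simp
    then show "ereal \<tau> * ereal (g q) + ereal (1 / 2 * (norm (q - z))\<^sup>2)
        < ereal \<tau> * ereal (g x) + ereal (1 / 2 * (norm (x - z))\<^sup>2)"
      using growth[of x] by simp
  qed
  then show ?thesis
    using growth[of u] by simp
qed

section \<open>The smallest eigenvalue of the Gram matrix\<close>

text \<open>A minimizer \<open>u\<close> of |Av| on the unit sphere is an eigenvector with
  eigenvalue c = |Au|^2. Hence the finite eigenvalue set is nonempty, its minimum is attained, and
  that minimum is at most c, the Rayleigh bound.\<close>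

lemma lambda_min_gram:
  fixes A :: "real ^ 'd ^ 'n"
  shows lambda_min_gram_nonneg: "0 \<le> lambda_min (transpose A ** A)"
    and lambda_min_gram_le: "lambda_min (transpose A ** A) * (norm v)\<^sup>2 \<le> (norm (A *v v))\<^sup>2"
proof -
  define M where "M = transpose A ** A"
  have M: "(M *v v) \<bullet> w = (A *v v) \<bullet> (A *v w)" for v w
    by (simp add: M_def dot_lmul_matrix flip: matrix_vector_mul_assoc)
  have "\<exists>v\<in>sphere 0 1. \<forall>w\<in>sphere 0 1. norm (A *v (v :: real ^ 'd)) \<le> norm (A *v w)"
    by (intro continuous_attains_inf continuous_intros) auto
  then obtain u :: "real ^ 'd" where u: "norm u = 1"
      "\<And>w. norm w = 1 \<Longrightarrow> norm (A *v u) \<le> norm (A *v w)"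
    by auto
  define c where "c = (norm (A *v u))\<^sup>2"
  have c: "c * (norm w)\<^sup>2 \<le> (norm (A *v w))\<^sup>2" for w
  proof (cases "w = 0")
    case False
    then have "norm (A *v u) * norm w \<le> norm (A *v w)"
      using u(2)[of "(1 / norm w) *\<^sub>R w"] by (simp add: matrix_vector_mult_scaleR field_simps)
    then show ?thesis
      unfolding c_def power_mult_distrib[symmetric] by (intro power_mono) auto
  qed simp
  \<comment> \<open>|Aw|^2 - c |w|^2 is nonnegative and vanishes at \<open>u\<close>, so its
    first-order term there vanishes. The summand 1 in the curvature bound keeps it positive even if
    \<open>A\<close> is zero.\<close>
  have "M *v u - c *\<^sub>R u = 0"
  proof (rule zero_if_quadratic_nonneg)
    define L where "L = onorm (\<lambda>x. A *v x)"
    show "0 < L\<^sup>2 + 1"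
      by (simp add: add_nonneg_pos)
    fix d
    have "norm (A *v d) \<le> L * norm d"
      unfolding L_def by (rule onorm) simp
    then have "(norm (A *v d))\<^sup>2 \<le> L\<^sup>2 * (norm d)\<^sup>2"
      unfolding power_mult_distrib[symmetric] by (intro power_mono) auto
    moreover have "(norm (A *v (u + d)))\<^sup>2 - c * (norm (u + d))\<^sup>2
        = (norm (A *v d))\<^sup>2 - c * (norm d)\<^sup>2 + 2 * ((M *v u - c *\<^sub>R u) \<bullet> d)"
      using u(1) M[of u d] by (simp add: c_def power2_norm_eq_inner matrix_vector_right_distrib
          inner_simps inner_commute algebra_simps norm_eq_1)
    moreover have "0 \<le> c * (norm d)\<^sup>2" "0 \<le> (norm d)\<^sup>2"
      by (auto simp: c_def)
    moreover have "(L\<^sup>2 + 1) / 2 * (norm d)\<^sup>2 = L\<^sup>2 * (norm d)\<^sup>2 / 2 + (norm d)\<^sup>2 / 2"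
      by (simp add: algebra_simps add_divide_distrib)
    ultimately show "0 \<le> (M *v u - c *\<^sub>R u) \<bullet> d + (L\<^sup>2 + 1) / 2 * (norm d)\<^sup>2"
      using c[of "u + d"] by linarith
  qed
  then have mem: "c \<in> real_eigenvalues M"
    using u(1) unfolding real_eigenvalues_def by (intro CollectI exI[of _ u]) auto
  have fin: "finite (real_eigenvalues M)"
    by (rule finite_real_eigenvalues_symmetric) (simp add: M_def matrix_transpose_mul)
  have "lambda_min M \<in> real_eigenvalues M"
    unfolding lambda_min_def using fin mem by (intro Min_in) auto
  then obtain w where w: "w \<noteq> 0" "M *v w = lambda_min M *\<^sub>R w"
    unfolding real_eigenvalues_def by auto
  have "lambda_min M * (norm w)\<^sup>2 = (norm (A *v w))\<^sup>2"
    using M[of w w] w by (simp add: power2_norm_eq_inner)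
  then have "0 \<le> lambda_min M * (norm w)\<^sup>2"
    by simp
  then show "0 \<le> lambda_min (transpose A ** A)"
    using w(1) by (simp add: M_def zero_le_mult_iff)
  have "lambda_min M \<le> c"
    unfolding lambda_min_def using fin mem by simp
  then show "lambda_min (transpose A ** A) * (norm v)\<^sup>2 \<le> (norm (A *v v))\<^sup>2"
    using c[of v] mult_right_mono[of "lambda_min M" c "(norm v)\<^sup>2"] by (simp add: M_def)
qed


section \<open>Saddle points of the Lagrangian\<close>

lemma lagrangian_gradient:
  assumes G: "\<And>x. GDERIV f x :> G x" and cvx: "strongly_convex 0 f"
  shows "lagrangian A f g x (G z) = ereal (g x + G z \<bullet> (A *v x) - (G z \<bullet> z - f z))"
  unfolding lagrangian_def convex_conjugate_gradient[OF G cvx] by simp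

lemma lagrangian_le: "lagrangian A f g x y \<le> ereal (g x + f (A *v x))"
proof -
  have "lagrangian A f g x y \<le> ereal (g x + y \<bullet> (A *v x)) - ereal (y \<bullet> (A *v x) - f (A *v x))"
    unfolding lagrangian_def by (intro ereal_minus_mono convex_conjugate_ge) simp
  then show ?thesis by simp
qed

text \<open>Maximality in the dual variable, tested at \<open>G (A *v xs)\<close> where the
  Lagrangian reaches its upper bound \<open>g xs + f (A *v xs)\<close>, forces equality in
  Fenchel-Young. So \<open>ys\<close> is a subgradient of \<open>f\<close> at
  \<open>A *v xs\<close>, hence the gradient.\<close>

lemma saddle_point_lagrangianD:
  assumes G: "\<And>x. GDERIV f x :> G x" and lip: "K-lipschitz_on UNIV G" and K: "0 < K"
    and cvx: "strongly_convex 0 f" and sp: "saddle_point (lagrangian A f g) (xs, ys)"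
  shows "ys = G (A *v xs)" and "g xs + ys \<bullet> (A *v xs) \<le> g x + ys \<bullet> (A *v x)"
proof -
  have max: "lagrangian A f g xs y \<le> lagrangian A f g xs ys" for y
    using sp by (simp add: saddle_point_def)
  have min: "lagrangian A f g xs ys \<le> lagrangian A f g x ys" for x
    using sp by (simp add: saddle_point_def)
  have "ereal (g xs + f (A *v xs)) \<le> ereal (g xs + ys \<bullet> (A *v xs)) - convex_conjugate f ys"
    using max[of "G (A *v xs)"] unfolding lagrangian_gradient[OF G cvx] by (simp add: lagrangian_def)
  then have le: "convex_conjugate f ys \<le> ereal (ys \<bullet> (A *v xs) - f (A *v xs))"
    by (cases "convex_conjugate f ys") auto
  show ys: "ys = G (A *v xs)"
  proof (rule subgradient_eq_gradient[OF G lip K])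
    fix w
    show "ys \<bullet> w - f w \<le> ys \<bullet> (A *v xs) - f (A *v xs)"
      using order_trans[OF convex_conjugate_ge le] by simp
  qed
  show "g xs + ys \<bullet> (A *v xs) \<le> g x + ys \<bullet> (A *v x)"
    using min[of x] unfolding ys lagrangian_gradient[OF G cvx] by simp
qed

text \<open>The saddle points are the pairs \<open>(p, G (A p))\<close> where \<open>p\<close> minimizes the primal objective
  \<open>f (A x) + g x\<close>.\<close>

lemma ex1_saddle_point_lagrangian:
  fixes A :: "real ^ 'd ^ 'n"
  assumes G: "\<And>x. GDERIV f x :> G x" and lip: "K-lipschitz_on UNIV G" and K: "0 < K"
    and cvx: "strongly_convex 0 f" and f: "strongly_convex \<delta> f" and "0 \<le> \<delta>"
    and g: "strongly_convex m g" and "0 \<le> m" and A: "\<And>v. c * (norm v)\<^sup>2 \<le> (norm (A *v v))\<^sup>2"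
    and pos: "0 < m + \<delta> * c"
  shows "\<exists>!p. saddle_point (lagrangian A f g) p"
proof -
  define F where "F x = f (A *v x) + g x" for x
  have F: "strongly_convex (m + \<delta> * c) F"
  proof (unfold strongly_convex_iff, intro allI impI, elim conjE)
    fix a b and s :: real
    assume s: "0 \<le> s" "s \<le> 1"
    have "A *v a + s *\<^sub>R (A *v b - A *v a) = A *v (a + s *\<^sub>R (b - a))"
      by (simp add: matrix_vector_right_distrib matrix_vector_mult_diff_distrib
          matrix_vector_mult_scaleR)
    moreover have "\<delta> / 2 * (s * (1 - s)) * (c * (norm (b - a))\<^sup>2)
        \<le> \<delta> / 2 * (s * (1 - s)) * (norm (A *v b - A *v a))\<^sup>2"
      using s \<open>0 \<le> \<delta>\<close> A[of "b - a"]
      by (intro mult_left_mono) (auto simp: matrix_vector_mult_diff_distrib)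
    ultimately show "F (a + s *\<^sub>R (b - a))
        \<le> (1 - s) * F a + s * F b - (m + \<delta> * c) / 2 * (s * (1 - s)) * (norm (b - a))\<^sup>2"
      using strongly_convex_ineq[OF f s, of "A *v a" "A *v b"] strongly_convex_ineq[OF g s, of a b]
      by (simp add: F_def algebra_simps add_divide_distrib diff_divide_distrib)
  qed
  obtain p where p: "\<And>x. F p \<le> F x"
    using strongly_convex_has_min[OF F pos] by blast
  \<comment> \<open>First-order optimality of \<open>p\<close> with only \<open>f\<close>
    linearized: move by \<open>s\<close> towards \<open>x\<close>, bound \<open>f\<close> by its
    quadratic model and \<open>g\<close> by convexity, then divide by \<open>s\<close>.\<close>
  have opt: "g p + G (A *v p) \<bullet> (A *v p) \<le> g x + G (A *v p) \<bullet> (A *v x)" for x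
  proof (rule le_of_le_add_mult_small)
    fix s :: real
    assume s: "0 < s" "s \<le> 1"
    define d where "d = A *v x - A *v p"
    have "A *v (p + s *\<^sub>R (x - p)) = A *v p + s *\<^sub>R d"
      by (simp add: d_def matrix_vector_right_distrib matrix_vector_mult_diff_distrib
          matrix_vector_mult_scaleR)
    then have "f (A *v p) + g p \<le> f (A *v p + s *\<^sub>R d) + g (p + s *\<^sub>R (x - p))"
      using p[of "p + s *\<^sub>R (x - p)"] by (simp add: F_def)
    also have "\<dots> \<le> (f (A *v p) + s * (G (A *v p) \<bullet> d) + K / 2 * (s\<^sup>2 * (norm d)\<^sup>2))
        + ((1 - s) * g p + s * g x - m / 2 * (s * (1 - s)) * (norm (x - p))\<^sup>2)"
      using smooth_upper_bound[OF G lip, of "A *v p" "s *\<^sub>R d"] strongly_convex_ineq[OF g, of s p x] s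
      by (simp add: power_mult_distrib)
    finally have "s * (g p + G (A *v p) \<bullet> (A *v p))
        \<le> s * (g x + G (A *v p) \<bullet> (A *v x) - m / 2 * (norm (x - p))\<^sup>2
          + s * (K / 2 * (norm d)\<^sup>2 + m / 2 * (norm (x - p))\<^sup>2))"
      by (simp add: d_def inner_simps algebra_simps power2_eq_square add_divide_distrib diff_divide_distrib)
    then show "g p + G (A *v p) \<bullet> (A *v p) \<le> g x + G (A *v p) \<bullet> (A *v x)
        + s * (K / 2 * (norm d)\<^sup>2 + m / 2 * (norm (x - p))\<^sup>2)"
      using s mult_nonneg_nonneg[OF \<open>0 \<le> m\<close> zero_le_power2[of "norm (x - p)"]] by simp
  qed
  show ?thesis
  proof (rule ex1I)
    show "saddle_point (lagrangian A f g) (p, G (A *v p))"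
      using lagrangian_le[of A f g p] opt
      by (auto simp: saddle_point_def lagrangian_gradient[OF G cvx] add_diff_eq le_diff_eq)
  next
    fix q
    assume q: "saddle_point (lagrangian A f g) q"
    obtain xs ys where xy: "q = (xs, ys)"
      by (cases q)
    note D = saddle_point_lagrangianD[OF G lip K cvx q[unfolded xy]]
    \<comment> \<open>The primal part of any saddle point minimizes \<open>F\<close>; growth at
      \<open>p\<close> then identifies the two.\<close>
    have min: "F xs \<le> F x" for x
      using D(2)[of x] strongly_convex_gradient_lower_bound[OF G cvx, of "A *v xs" "A *v x"]
      by (simp add: F_def D(1) inner_simps)
    have "(m + \<delta> * c) / 2 * (norm (xs - p))\<^sup>2 \<le> 0"
      using strongly_convex_growth[OF F p, of xs] min[of p] by linarith
    then have "xs = p"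
      using pos by (simp add: mult_le_0_iff)
    then show "q = (p, G (A *v p))"
      using xy D(1) by simp
  qed
qed

section \<open>One iteration contracts the potential\<close>

text \<open>The left side is the minimum of the right side over \<open>u\<close>; multiplied by
  \<open>p + q\<close>, the difference is a perfect square.\<close>

lemma weighted_norm_squares_ge:
  fixes a u :: "'a::real_inner"
  assumes "0 \<le> p" "0 < q"
  shows "p * q / (p + q) * (norm a)\<^sup>2 \<le> p * (norm u)\<^sup>2 + q * (norm (a - u))\<^sup>2"
proof -
  have "(p + q) * (p * (norm u)\<^sup>2 + q * (norm (a - u))\<^sup>2) - p * q * (norm a)\<^sup>2
      = (norm (p *\<^sub>R u - q *\<^sub>R (a - u)))\<^sup>2"
    by (simp add: power2_norm_eq_inner inner_simps inner_commute algebra_simps)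
  then have "p * q * (norm a)\<^sup>2 \<le> (p + q) * (p * (norm u)\<^sup>2 + q * (norm (a - u))\<^sup>2)"
    by (metis diff_ge_0_iff_ge zero_le_power2)
  then show ?thesis
    using assms by (simp add: field_simps)
qed


text \<open>Capitals are the new iterates, \<open>x\<close> and \<open>y\<close> the current ones,
  \<open>p\<close> the previous primal one. The claim reads: gap plus new potential is at most
  \<theta> times the old potential. The cross term in the potential pairs with the extrapolation;
  \<open>z\<close> is the point whose gradient is \<open>Y\<close>, so
  \<open>Y \<bullet> z - f z\<close> stands for the conjugate at \<open>Y\<close>.\<close>

lemma bpd_step_inequality:
  fixes A :: "real ^ 'd ^ 'n" and f :: "real ^ 'n \<Rightarrow> real" and g :: "real ^ 'd \<Rightarrow> real"
  assumes \<sigma>: "0 < \<sigma>" and \<tau>: "0 < \<tau>" and step: "\<sigma> * \<tau> * L\<^sup>2 = 1"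
    and "0 \<le> \<delta>" "0 \<le> \<theta>" "\<theta> \<le> 1"
    and L: "\<And>v. norm (A *v v) \<le> L * norm v"
    and \<mu>: "\<And>v. \<mu>\<^sup>2 * (norm v)\<^sup>2 \<le> (norm (A *v v))\<^sup>2"
    and \<theta>x: "1 / (2 * \<tau>) - \<delta> * \<sigma> / (2 * (\<delta> + 2 * \<sigma>)) * \<mu>\<^sup>2 \<le> \<theta> * (1 / (2 * \<tau>) + m / 2)"
    and \<theta>y: "1 / (2 * \<sigma>) \<le> \<theta> * (1 / (2 * \<sigma>) + \<gamma> / 4)"
    and primal: "g X + Y \<bullet> (A *v X) + 1 / (2 * \<tau>) * (norm (X - x))\<^sup>2
        + (1 / (2 * \<tau>) + m / 2) * (norm (X - xs))\<^sup>2
      \<le> g xs + Y \<bullet> (A *v xs) + 1 / (2 * \<tau>) * (norm (x - xs))\<^sup>2"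
    and dual: "Y = y + \<sigma> *\<^sub>R (A *v (x + \<theta> *\<^sub>R (x - p))) - \<sigma> *\<^sub>R z"
    and bregman: "\<delta> / 4 * (norm (z - A *v xs))\<^sup>2 + \<gamma> / 4 * (norm (Y - ys))\<^sup>2
      \<le> f z - f (A *v xs) - ys \<bullet> (z - A *v xs)"
  shows "(g X + ys \<bullet> (A *v X) - (ys \<bullet> (A *v xs) - f (A *v xs)))
        - (g xs + Y \<bullet> (A *v xs) - (Y \<bullet> z - f z))
      + ((1 / (2 * \<tau>) + m / 2) * (norm (X - xs))\<^sup>2 + (1 / (2 * \<sigma>) + \<gamma> / 4) * (norm (Y - ys))\<^sup>2
        + 1 / (2 * \<tau>) * (norm (X - x))\<^sup>2 + (Y - ys) \<bullet> (A *v (X - x)))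
    \<le> \<theta> * ((1 / (2 * \<tau>) + m / 2) * (norm (x - xs))\<^sup>2 + (1 / (2 * \<sigma>) + \<gamma> / 4) * (norm (y - ys))\<^sup>2
        + 1 / (2 * \<tau>) * (norm (x - p))\<^sup>2 + (y - ys) \<bullet> (A *v (x - p)))"
proof -
  define a b D u where "a = A *v (x - xs)" and "b = A *v (x - p)"
    and "D = (1 / \<sigma>) *\<^sub>R (Y - y)" and "u = z - A *v xs"
  have Y: "Y = y + \<sigma> *\<^sub>R D"
    using \<sigma> by (simp add: D_def)
  have u: "u = a + \<theta> *\<^sub>R b - D"
  proof -
    have "D = A *v (x + \<theta> *\<^sub>R (x - p)) - z"
      using \<sigma> by (simp add: D_def dual flip: scaleR_diff_right)
    then show ?thesis
      by (simp add: u_def a_def b_def matrix_vector_right_distrib matrix_vector_mult_diff_distrib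
          matrix_vector_mult_scaleR)
  qed
  have "(norm (D - \<theta> *\<^sub>R b))\<^sup>2 = (norm D)\<^sup>2 - 2 * \<theta> * (D \<bullet> b) + \<theta> * \<theta> * (norm b)\<^sup>2"
    by (simp add: power2_norm_eq_inner inner_simps inner_commute algebra_simps)
  \<comment> \<open>Only a single factor \<theta> may remain, since this term is later absorbed by
    \<theta>/(2\<tau>) |x - p|^2 from the old potential.\<close>
  moreover have "\<theta> * \<theta> * (norm b)\<^sup>2 \<le> \<theta> * (norm b)\<^sup>2"
    using \<open>0 \<le> \<theta>\<close> \<open>\<theta> \<le> 1\<close> by (intro mult_right_mono) (auto simp: mult_left_le)
  ultimately have "(norm (D - \<theta> *\<^sub>R b))\<^sup>2 \<le> (norm D)\<^sup>2 - 2 * \<theta> * (D \<bullet> b) + \<theta> * (norm b)\<^sup>2"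
    by linarith
  then have "\<sigma> / 2 * (norm (D - \<theta> *\<^sub>R b))\<^sup>2
      \<le> \<sigma> / 2 * ((norm D)\<^sup>2 - 2 * \<theta> * (D \<bullet> b) + \<theta> * (norm b)\<^sup>2)"
    using \<sigma> by (intro mult_left_mono) auto
  then have sq: "\<sigma> / 2 * (norm (D - \<theta> *\<^sub>R b))\<^sup>2
      \<le> \<sigma> / 2 * (norm D)\<^sup>2 - \<sigma> * \<theta> * (D \<bullet> b) + \<sigma> / 2 * \<theta> * (norm b)\<^sup>2"
    by (simp add: algebra_simps)
  have "\<delta> * \<sigma> / (2 * (\<delta> + 2 * \<sigma>)) * (\<mu>\<^sup>2 * (norm (x - xs))\<^sup>2)
      \<le> \<delta> * \<sigma> / (2 * (\<delta> + 2 * \<sigma>)) * (norm a)\<^sup>2"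
    unfolding a_def using \<open>0 \<le> \<delta>\<close> \<sigma> by (intro mult_left_mono \<mu>) auto
  \<comment> \<open>The form pq/(p + q) with weights p = \<delta>/4 and q = \<sigma>/2.\<close>
  also have "\<delta> * \<sigma> / (2 * (\<delta> + 2 * \<sigma>)) = \<delta> / 4 * (\<sigma> / 2) / (\<delta> / 4 + \<sigma> / 2)"
    using \<open>0 \<le> \<delta>\<close> \<sigma> by (simp add: divide_simps add_nonneg_eq_0_iff)
  also have "\<delta> / 4 * (\<sigma> / 2) / (\<delta> / 4 + \<sigma> / 2) * (norm a)\<^sup>2
      \<le> \<delta> / 4 * (norm u)\<^sup>2 + \<sigma> / 2 * (norm (a - u))\<^sup>2"
    using \<open>0 \<le> \<delta>\<close> \<sigma> by (intro weighted_norm_squares_ge) auto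
  also have "a - u = D - \<theta> *\<^sub>R b"
    by (simp add: u)
  finally have core: "\<delta> * \<sigma> / (2 * (\<delta> + 2 * \<sigma>)) * \<mu>\<^sup>2 * (norm (x - xs))\<^sup>2
      \<le> \<delta> / 4 * (norm u)\<^sup>2 + \<sigma> / 2 * (norm D)\<^sup>2 - \<sigma> * \<theta> * (D \<bullet> b) + \<sigma> / 2 * \<theta> * (norm b)\<^sup>2"
    using sq by (simp add: mult.assoc)
  have "(norm b)\<^sup>2 \<le> L\<^sup>2 * (norm (x - p))\<^sup>2"
    unfolding b_def power_mult_distrib[symmetric] by (intro power_mono L) auto
  then have "\<sigma> / 2 * \<theta> * (norm b)\<^sup>2 \<le> \<sigma> / 2 * \<theta> * (L\<^sup>2 * (norm (x - p))\<^sup>2)"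
    using \<sigma> \<open>0 \<le> \<theta>\<close> by (intro mult_left_mono) auto
  also have "\<dots> = \<theta> * (1 / (2 * \<tau>) * (norm (x - p))\<^sup>2)"
  proof -
    have "\<sigma> * L\<^sup>2 = 1 / \<tau>"
      using step \<tau> by (simp add: field_simps)
    then have "\<sigma> * L\<^sup>2 * (\<theta> / 2 * (norm (x - p))\<^sup>2) = 1 / \<tau> * (\<theta> / 2 * (norm (x - p))\<^sup>2)"
      by simp
    then show ?thesis
      by (simp add: algebra_simps)
  qed
  finally have b: "\<sigma> / 2 * \<theta> * (norm b)\<^sup>2 \<le> \<theta> * (1 / (2 * \<tau>) * (norm (x - p))\<^sup>2)" .
  have x: "(1 / (2 * \<tau>) - \<delta> * \<sigma> / (2 * (\<delta> + 2 * \<sigma>)) * \<mu>\<^sup>2) * (norm (x - xs))\<^sup>2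
      \<le> \<theta> * (1 / (2 * \<tau>) + m / 2) * (norm (x - xs))\<^sup>2"
    by (intro mult_right_mono \<theta>x) auto
  have y: "1 / (2 * \<sigma>) * (norm (y - ys))\<^sup>2 \<le> \<theta> * (1 / (2 * \<sigma>) + \<gamma> / 4) * (norm (y - ys))\<^sup>2"
    by (intro mult_right_mono \<theta>y) auto
  have Yys: "1 / (2 * \<sigma>) * (norm (Y - ys))\<^sup>2
      = 1 / (2 * \<sigma>) * (norm (y - ys))\<^sup>2 - \<sigma> / 2 * (norm D)\<^sup>2 + (Y - ys) \<bullet> D"
  proof -
    have "(norm (Y - ys))\<^sup>2 = (norm (y - ys))\<^sup>2 - \<sigma> * \<sigma> * (norm D)\<^sup>2 + 2 * \<sigma> * ((Y - ys) \<bullet> D)"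
      unfolding Y power2_norm_eq_inner by (simp add: inner_simps inner_commute algebra_simps)
    then show ?thesis
      using \<sigma> by (simp add: field_simps)
  qed
  \<comment> \<open>Splitting \<open>Y - ys\<close> in its product with \<open>b\<close> yields the
    old cross term times \<theta>; the remainder \<sigma>\<theta> D.b is the one controlled by
    \<open>core\<close>.\<close>
  have bilinear: "(Y - ys) \<bullet> z - (Y - ys) \<bullet> (A *v X)
      = - ((Y - ys) \<bullet> D) - (Y - ys) \<bullet> (A *v (X - x)) + \<theta> * ((y - ys) \<bullet> b) + \<sigma> * \<theta> * (D \<bullet> b)"
  proof -
    have "z - A *v X = \<theta> *\<^sub>R b - D - A *v (X - x)"
      using u by (simp add: u_def a_def matrix_vector_mult_diff_distrib algebra_simps)
    then have "(Y - ys) \<bullet> z - (Y - ys) \<bullet> (A *v X)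
        = \<theta> * ((Y - ys) \<bullet> b) - (Y - ys) \<bullet> D - (Y - ys) \<bullet> (A *v (X - x))"
      by (metis inner_diff_right inner_scaleR_right)
    also have "(Y - ys) \<bullet> b = (y - ys) \<bullet> b + \<sigma> * (D \<bullet> b)"
      unfolding Y by (simp add: inner_simps)
    finally show ?thesis
      by (simp add: algebra_simps)
  qed
  show ?thesis
    using core b x y Yys bilinear primal bregman
    unfolding u_def[symmetric] b_def[symmetric]
    by (simp add: u_def inner_diff_left inner_diff_right distrib_left distrib_right left_diff_distrib
        right_diff_distrib)
qed


section \<open>Linear convergence of the iterates and of the gap\<close>

theorem theorem1:
  fixes A :: "real ^ 'd ^ 'n"
    and f :: "real ^ 'n \<Rightarrow> real" and g :: "real ^ 'd \<Rightarrow> real"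
    and \<gamma> \<delta> lam \<mu> L \<sigma> \<tau> \<theta> \<theta>\<^sub>x \<theta>\<^sub>y :: real
    and x :: "nat \<Rightarrow> real ^ 'd" and y :: "nat \<Rightarrow> real ^ 'n"
  assumes "A \<noteq> 0"
    and "convex_on UNIV f" and "convex_on UNIV g"
    and "\<mu> = sqrt (lambda_min (transpose A ** A))"
    and "L = spectral_norm A"
    and "\<gamma> > 0" and "\<delta> \<ge> 0" and "\<gamma> * \<delta> \<le> 1"
    and "strongly_convex \<delta> f" and "lipschitz_smooth (1 / \<gamma>) f"
    and "lam \<ge> 0" and "strongly_convex lam g"
    and "lam + \<delta> * \<mu>\<^sup>2 > 0"
    and "\<sigma> = 1 / L * sqrt ((lam + \<delta> * \<mu>\<^sup>2) / \<gamma>)"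
    and "\<tau> = 1 / L * sqrt (\<gamma> / (lam + \<delta> * \<mu>\<^sup>2))"
    and "\<theta>\<^sub>x = (1 - \<delta> / (\<delta> + 2 * \<sigma>) * (\<mu>\<^sup>2 / L\<^sup>2)) * (1 / (1 + \<tau> * lam))"
    and "\<theta>\<^sub>y = 1 / (1 + \<sigma> * \<gamma> / 2)"
    and "\<theta> = max \<theta>\<^sub>x \<theta>\<^sub>y"
    and "bpd_iterates A f g \<tau> \<sigma> \<theta> x y"
  shows "(\<exists>!p. saddle_point (lagrangian A f g) p) \<and>
    (\<forall>xs ys C. saddle_point (lagrangian A f g) (xs, ys) \<longrightarrow>
      C = (1 / (2 * \<tau>) + lam / 2) * (norm (x 0 - xs))\<^sup>2
            + (1 / (2 * \<sigma>) + \<gamma> / 4) * (norm (y 0 - ys))\<^sup>2 \<longrightarrow>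
      (\<forall>t\<ge>1.
        (1 / (2 * \<tau>) + lam / 2) * (norm (x t - xs))\<^sup>2 + \<gamma> / 4 * (norm (y t - ys))\<^sup>2 \<le> \<theta> ^ t * C \<and>
        lagrangian A f g (x t) ys - lagrangian A f g xs (y t) \<le> ereal (\<theta> ^ t * C)))"
proof -
  define \<kappa> where "\<kappa> = \<delta> * \<sigma> / (2 * (\<delta> + 2 * \<sigma>))"
  obtain G where G: "\<And>x. GDERIV f x :> G x" and lip: "(1 / \<gamma>)-lipschitz_on UNIV G"
    using \<open>lipschitz_smooth (1 / \<gamma>) f\<close> unfolding lipschitz_smooth_def by blast
  have cvx: "strongly_convex 0 f"
    using \<open>convex_on UNIV f\<close> by (simp add: strongly_convex_def)
  have K: "0 < 1 / \<gamma>"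
    using \<open>\<gamma> > 0\<close> by simp
  have adj: "(transpose A *v w) \<bullet> v = w \<bullet> (A *v v)" for v w
    using dot_lmul_matrix[of w A v] by simp
  have L: "norm (A *v v) \<le> L * norm v" for v
    unfolding \<open>L = spectral_norm A\<close> spectral_norm_def by (rule onorm) simp
  have "0 < L"
  proof -
    obtain v where "A *v v \<noteq> 0"
      using \<open>A \<noteq> 0\<close> by (metis matrix_eq matrix_vector_mult_0)
    then have "0 < L * norm v"
      using L[of v] by (smt (verit) zero_less_norm_iff)
    then show ?thesis
      by (simp add: zero_less_mult_iff)
  qed
  have \<mu>: "\<mu>\<^sup>2 * (norm v)\<^sup>2 \<le> (norm (A *v v))\<^sup>2" for v
    using lambda_min_gram_le[of A v] lambda_min_gram_nonneg[of A] \<open>\<mu> = _\<close> by simp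
  have \<sigma>: "0 < \<sigma>" and \<tau>: "0 < \<tau>"
    using \<open>\<sigma> = _\<close> \<open>\<tau> = _\<close> \<open>0 < L\<close> \<open>\<gamma> > 0\<close> \<open>lam + \<delta> * \<mu>\<^sup>2 > 0\<close> by simp_all
  have step: "\<sigma> * \<tau> * L\<^sup>2 = 1"
  proof -
    have "sqrt ((lam + \<delta> * \<mu>\<^sup>2) / \<gamma>) * sqrt (\<gamma> / (lam + \<delta> * \<mu>\<^sup>2)) = 1"
      using \<open>\<gamma> > 0\<close> \<open>lam + \<delta> * \<mu>\<^sup>2 > 0\<close> by (simp flip: real_sqrt_mult)
    then show ?thesis
      using \<open>0 < L\<close> unfolding \<open>\<sigma> = _\<close> \<open>\<tau> = _\<close> by (simp add: power2_eq_square)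
  qed
  have \<kappa>: "0 \<le> \<kappa>"
    using \<sigma> \<open>\<delta> \<ge> 0\<close> by (simp add: \<kappa>_def)
  \<comment> \<open>\<open>\<theta>\<^sub>x\<close> is exactly the ratio of the primal weights
    before and after a step; the step size relation turns 1/(\<tau> L^2) into \<sigma>.\<close>
  have "1 / (2 * \<tau>) - \<kappa> * \<mu>\<^sup>2 = \<theta>\<^sub>x * (1 / (2 * \<tau>) + lam / 2)"
  proof -
    have "0 < 1 + \<tau> * lam"
      using \<tau> \<open>lam \<ge> 0\<close> by (simp add: add_pos_nonneg)
    then have "1 / (1 + \<tau> * lam) * (1 / (2 * \<tau>) + lam / 2) = 1 / (2 * \<tau>)"
      using \<tau> by (simp add: field_simps)
    then have "\<theta>\<^sub>x * (1 / (2 * \<tau>) + lam / 2) = (1 - \<delta> / (\<delta> + 2 * \<sigma>) * (\<mu>\<^sup>2 / L\<^sup>2)) * (1 / (2 * \<tau>))"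
      unfolding \<open>\<theta>\<^sub>x = _\<close> mult.assoc by (rule arg_cong)
    also have "\<dots> = 1 / (2 * \<tau>) - \<delta> / (2 * (\<delta> + 2 * \<sigma>)) * \<mu>\<^sup>2 * (1 / (\<tau> * L\<^sup>2))"
    proof -
      have "(1 - \<delta> / q * (\<mu>\<^sup>2 / L\<^sup>2)) * (1 / (2 * \<tau>))
          = 1 / (2 * \<tau>) - \<delta> / (2 * q) * \<mu>\<^sup>2 * (1 / (\<tau> * L\<^sup>2))" for q
        by (simp add: diff_divide_distrib ac_simps)
      then show ?thesis .
    qed
    also have "1 / (\<tau> * L\<^sup>2) = \<sigma>"
      using step \<tau> \<open>0 < L\<close> by (simp add: field_simps)
    finally show ?thesis
      by (simp add: \<kappa>_def)
  qed
  then have \<theta>x: "1 / (2 * \<tau>) - \<kappa> * \<mu>\<^sup>2 \<le> \<theta> * (1 / (2 * \<tau>) + lam / 2)"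
    using \<open>\<theta> = _\<close> \<tau> \<open>lam \<ge> 0\<close> by (simp add: mult_right_mono)
  have "1 / (2 * \<sigma>) = \<theta>\<^sub>y * (1 / (2 * \<sigma>) + \<gamma> / 4)"
  proof -
    have "1 / (2 * \<sigma>) + \<gamma> / 4 = (1 + \<sigma> * \<gamma> / 2) * (1 / (2 * \<sigma>))"
      using \<sigma> by (simp add: field_simps)
    moreover have "1 + \<sigma> * \<gamma> / 2 \<noteq> 0"
      using mult_pos_pos[OF \<sigma> \<open>\<gamma> > 0\<close>] by linarith
    ultimately show ?thesis
      unfolding \<open>\<theta>\<^sub>y = _\<close> by simp
  qed
  also have "\<dots> \<le> \<theta> * (1 / (2 * \<sigma>) + \<gamma> / 4)"
    using \<open>\<theta> = _\<close> \<sigma> \<open>\<gamma> > 0\<close> by (intro mult_right_mono) auto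
  finally have \<theta>y: "1 / (2 * \<sigma>) \<le> \<theta> * (1 / (2 * \<sigma>) + \<gamma> / 4)" .
  have "0 \<le> \<theta>\<^sub>y" "\<theta>\<^sub>y \<le> 1"
    using \<sigma> \<open>\<gamma> > 0\<close> unfolding \<open>\<theta>\<^sub>y = _\<close> by (auto simp: divide_le_eq add_pos_pos)
  moreover have "\<theta>\<^sub>x \<le> 1"
  proof -
    have "0 \<le> \<delta> / (\<delta> + 2 * \<sigma>) * (\<mu>\<^sup>2 / L\<^sup>2)"
      using \<sigma> \<open>\<delta> \<ge> 0\<close> by simp
    then have "(1 - \<delta> / (\<delta> + 2 * \<sigma>) * (\<mu>\<^sup>2 / L\<^sup>2)) * (1 / (1 + \<tau> * lam))
        \<le> 1 * (1 / (1 + \<tau> * lam))"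
      using \<tau> \<open>lam \<ge> 0\<close> by (intro mult_right_mono) auto
    moreover have "1 / (1 + \<tau> * lam) \<le> 1"
      using \<tau> \<open>lam \<ge> 0\<close> by (auto simp: divide_le_eq add_pos_nonneg)
    ultimately show ?thesis
      unfolding \<open>\<theta>\<^sub>x = _\<close> by linarith
  qed
  ultimately have \<theta>: "0 \<le> \<theta>" "\<theta> \<le> 1"
    using \<open>\<theta> = _\<close> by auto
  obtain x' where x'0: "x' 0 = x 0"
    and yS: "\<And>t. y (Suc t) = prox \<sigma> (convex_conjugate f) (y t + \<sigma> *\<^sub>R (A *v x' t))"
    and xS: "\<And>t. x (Suc t) = prox \<tau> (\<lambda>z. ereal (g z)) (x t - \<tau> *\<^sub>R (transpose A *v y (Suc t)))"
    and x'S: "\<And>t. x' (Suc t) = x (Suc t) + \<theta> *\<^sub>R (x (Suc t) - x t)"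
    using \<open>bpd_iterates A f g \<tau> \<sigma> \<theta> x y\<close> unfolding bpd_iterates_def by blast
  \<comment> \<open>By truncated subtraction \<open>x (0 - 1) = x 0\<close>, so there is no extrapolation at \<open>t = 0\<close>.\<close>
  have x': "x' t = x t + \<theta> *\<^sub>R (x t - x (t - 1))" for t
    using x'0 x'S by (cases t) auto
  have "\<exists>z. y (Suc t) = G z \<and> G z = (y t + \<sigma> *\<^sub>R (A *v x' t)) - \<sigma> *\<^sub>R z" for t
    using prox_convex_conjugate[OF G lip K cvx \<sigma>, of "y t + \<sigma> *\<^sub>R (A *v x' t)"] yS[of t] by metis
  then obtain z where yG: "\<And>t. y (Suc t) = G (z t)"
    and yz: "\<And>t. G (z t) = (y t + \<sigma> *\<^sub>R (A *v x' t)) - \<sigma> *\<^sub>R z t"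
    by metis
  have ex1: "\<exists>!p. saddle_point (lagrangian A f g) p"
    by (rule ex1_saddle_point_lagrangian[OF G lip K cvx \<open>strongly_convex \<delta> f\<close> \<open>\<delta> \<ge> 0\<close>
        \<open>strongly_convex lam g\<close> \<open>lam \<ge> 0\<close> \<mu> \<open>lam + \<delta> * \<mu>\<^sup>2 > 0\<close>])
  have rate: "(1 / (2 * \<tau>) + lam / 2) * (norm (x t - xs))\<^sup>2 + \<gamma> / 4 * (norm (y t - ys))\<^sup>2 \<le> \<theta> ^ t * C \<and>
      lagrangian A f g (x t) ys - lagrangian A f g xs (y t) \<le> ereal (\<theta> ^ t * C)"
    if sp: "saddle_point (lagrangian A f g) (xs, ys)"
      and C: "C = (1 / (2 * \<tau>) + lam / 2) * (norm (x 0 - xs))\<^sup>2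
        + (1 / (2 * \<sigma>) + \<gamma> / 4) * (norm (y 0 - ys))\<^sup>2"
      and t: "t \<ge> 1" for xs ys C t
  proof -
    have ys: "ys = G (A *v xs)" and opt: "\<And>v. g xs + ys \<bullet> (A *v xs) \<le> g v + ys \<bullet> (A *v v)"
      using saddle_point_lagrangianD[OF G lip K cvx sp] by blast+
    \<comment> \<open>At \<open>t = 0\<close> the truncated index makes the last two terms vanish,
      so \<open>V 0\<close> is \<open>C\<close>.\<close>
    define V where "V t = (1 / (2 * \<tau>) + lam / 2) * (norm (x t - xs))\<^sup>2
      + (1 / (2 * \<sigma>) + \<gamma> / 4) * (norm (y t - ys))\<^sup>2
      + 1 / (2 * \<tau>) * (norm (x t - x (t - 1)))\<^sup>2 + (y t - ys) \<bullet> (A *v (x t - x (t - 1)))" for t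
    \<comment> \<open>The gap at iterate \<open>Suc t\<close>, in real form:
      \<open>y (Suc t)\<close> is a gradient of \<open>f\<close>, whereas the conjugate may be
      infinite at \<open>y 0\<close>.\<close>
    define gap where "gap t = (g (x (Suc t)) + ys \<bullet> (A *v x (Suc t)) - (ys \<bullet> (A *v xs) - f (A *v xs)))
      - (g xs + y (Suc t) \<bullet> (A *v xs) - (y (Suc t) \<bullet> z t - f (z t)))" for t
    have gap0: "0 \<le> gap t" for t
      using opt[of "x (Suc t)"] strongly_convex_gradient_lower_bound[OF G cvx, of "z t" "A *v xs"]
      by (simp add: gap_def yG inner_diff_right)
    have lag: "lagrangian A f g (x (Suc t)) ys - lagrangian A f g xs (y (Suc t)) = ereal (gap t)" for t
      unfolding yG ys lagrangian_gradient[OF G cvx] by (simp add: gap_def yG ys)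
    \<comment> \<open>As \<sigma> \<tau> L^2 = 1, Young's inequality absorbs the cross term into
      1/(2\<sigma>) |y - ys|^2 and the step term, leaving the weight \<gamma>/4.\<close>
    have V_ge: "(1 / (2 * \<tau>) + lam / 2) * (norm (x t - xs))\<^sup>2 + \<gamma> / 4 * (norm (y t - ys))\<^sup>2 \<le> V t" for t
    proof -
      let ?v = "x t - x (t - 1)" and ?w = "y t - ys"
      have "- (?w \<bullet> (A *v ?v)) \<le> norm ?w * (L * norm ?v)"
        using norm_cauchy_schwarz[of "- ?w" "A *v ?v"] mult_left_mono[OF L, of "norm ?w" ?v]
        unfolding inner_minus_left norm_minus_cancel by simp
      moreover have "norm ?w * (L * norm ?v)
          \<le> 1 / (2 * \<sigma>) * (norm ?w)\<^sup>2 + 1 / (2 * \<tau>) * (norm ?v)\<^sup>2"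
      proof -
        have \<tau>_eq: "1 / (2 * \<tau>) = \<sigma> / 2 * L\<^sup>2"
          using step \<tau> by (simp add: field_simps)
        have "1 / (2 * \<sigma>) * (norm ?w)\<^sup>2 + 1 / (2 * \<tau>) * (norm ?v)\<^sup>2 - norm ?w * (L * norm ?v)
            = 1 / (2 * \<sigma>) * (norm ?w - \<sigma> * L * norm ?v)\<^sup>2"
          using \<sigma> unfolding \<tau>_eq by (simp add: power2_eq_square field_simps)
        moreover have "0 \<le> 1 / (2 * \<sigma>) * (norm ?w - \<sigma> * L * norm ?v)\<^sup>2"
          using \<sigma> by simp
        ultimately show ?thesis
          by linarith
      qed
      ultimately show ?thesis
        by (simp add: V_def distrib_right)
    qed
    have V0: "0 \<le> V t" for t
    proof (rule order_trans[OF _ V_ge])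
      show "0 \<le> (1 / (2 * \<tau>) + lam / 2) * (norm (x t - xs))\<^sup>2 + \<gamma> / 4 * (norm (y t - ys))\<^sup>2"
        using \<tau> \<open>lam \<ge> 0\<close> \<open>\<gamma> > 0\<close> by (intro add_nonneg_nonneg mult_nonneg_nonneg) auto
    qed
    have "gap t + V (Suc t) \<le> \<theta> * V t" for t
      unfolding gap_def V_def diff_Suc_1
    proof (rule bpd_step_inequality[OF \<sigma> \<tau> step \<open>\<delta> \<ge> 0\<close> \<theta> L \<mu> \<theta>x[unfolded \<kappa>_def] \<theta>y])
      let ?X = "x (Suc t)" and ?Y = "y (Suc t)"
      have prox: "\<tau> * g ?X + 1 / 2 * (norm (?X - (x t - \<tau> *\<^sub>R (transpose A *v ?Y))))\<^sup>2
          + (\<tau> * lam + 1) / 2 * (norm (xs - ?X))\<^sup>2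
          \<le> \<tau> * g xs + 1 / 2 * (norm (xs - (x t - \<tau> *\<^sub>R (transpose A *v ?Y))))\<^sup>2"
        by (rule prox_strongly_convex[OF \<open>strongly_convex lam g\<close> \<open>lam \<ge> 0\<close> \<tau> xS])
      \<comment> \<open>The last bracket is free of \<open>v\<close> and cancels between the two
        sides of \<open>prox\<close>.\<close>
      have expand: "(norm (v - (x t - \<tau> *\<^sub>R (transpose A *v ?Y))))\<^sup>2
          = (norm (v - x t))\<^sup>2 + 2 * \<tau> * (?Y \<bullet> (A *v v))
            + ((norm (\<tau> *\<^sub>R (transpose A *v ?Y)))\<^sup>2 - 2 * \<tau> * ((transpose A *v ?Y) \<bullet> x t))" for v
        unfolding adj[symmetric]
        by (simp only: power2_norm_eq_inner) (simp add: inner_simps inner_commute algebra_simps)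
      have "\<tau> * (g ?X + ?Y \<bullet> (A *v ?X) + 1 / (2 * \<tau>) * (norm (?X - x t))\<^sup>2
          + (1 / (2 * \<tau>) + lam / 2) * (norm (?X - xs))\<^sup>2)
        \<le> \<tau> * (g xs + ?Y \<bullet> (A *v xs) + 1 / (2 * \<tau>) * (norm (x t - xs))\<^sup>2)"
        using prox[unfolded expand] \<tau>
        by (simp add: algebra_simps norm_minus_commute add_divide_distrib)
      then show "g ?X + ?Y \<bullet> (A *v ?X) + 1 / (2 * \<tau>) * (norm (?X - x t))\<^sup>2
          + (1 / (2 * \<tau>) + lam / 2) * (norm (?X - xs))\<^sup>2
        \<le> g xs + ?Y \<bullet> (A *v xs) + 1 / (2 * \<tau>) * (norm (x t - xs))\<^sup>2"
        using \<tau> by simp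
      show "?Y = y t + \<sigma> *\<^sub>R (A *v (x t + \<theta> *\<^sub>R (x t - x (t - 1)))) - \<sigma> *\<^sub>R z t"
        using yG yz x' by simp
      show "\<delta> / 4 * (norm (z t - A *v xs))\<^sup>2 + \<gamma> / 4 * (norm (?Y - ys))\<^sup>2
        \<le> f (z t) - f (A *v xs) - ys \<bullet> (z t - A *v xs)"
        using strongly_convex_gradient_lower_bound[OF G \<open>strongly_convex \<delta> f\<close>, of "A *v xs" "z t"]
          smooth_convex_cocoercive[OF G lip cvx \<open>\<gamma> > 0\<close>, of "A *v xs" "z t"]
        unfolding ys yG by simp
    qed
    note V_step = this
    have V_pow: "V t \<le> \<theta> ^ t * C" for t
    proof (induction t)
      case 0
      then show ?case
        by (simp add: V_def C)
    next
      case (Suc t)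
      have "V (Suc t) \<le> \<theta> * V t"
        using V_step[of t] gap0[of t] by linarith
      also have "\<dots> \<le> \<theta> * (\<theta> ^ t * C)"
        using Suc \<theta> by (intro mult_left_mono)
      finally show ?case
        by (simp add: mult.assoc)
    qed
    obtain k where k: "t = Suc k"
      using t by (cases t) auto
    \<comment> \<open>Dropping the nonnegative \<open>V (Suc k)\<close> keeps the factor \<theta> of
      this step, so the exponent is \<open>t\<close> rather than \<open>k\<close>.\<close>
    have "gap k \<le> \<theta> * V k"
      using V_step[of k] V0[of "Suc k"] by linarith
    also have "\<dots> \<le> \<theta> * (\<theta> ^ k * C)"
      using V_pow \<theta> by (intro mult_left_mono)
    finally have "lagrangian A f g (x t) ys - lagrangian A f g xs (y t) \<le> ereal (\<theta> ^ t * C)"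
      unfolding k lag by (simp add: mult.assoc)
    then show ?thesis
      using order_trans[OF V_ge V_pow] by blast
  qed
  show ?thesis
    using ex1 rate by blast
qed

end
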